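(* Let $d \geq 2$, let $X \subset \mathbb{R}^d$, let $\theta \in (0,1)$, and let $k$ be an integer with $1 \leq k < d$. Then $$\dim_{\mathrm{A}}^{\theta} P_V X \ \geq \ \dim_{\mathrm{A}}^{\theta,k} X$$ for $\gamma_{d,k}$-almost all $V \in G(d,k)$.
   Context: $G(d,k)$ is the Grassmannian of $k$-dimensional linear subspaces $V \subseteq \mathbb{R}^d$, equipped with its rotation-invariant Borel probability measure $\gamma_{d,k}$. $P_V \colon \mathbb{R}^d \to V$ is orthogonal projection onto $V$, and $V$ is identified with $\mathbb{R}^k$. $B(x,R)$ is the closed ball with centre $x$ and radius $R$. $N_r(A)$ is the smallest number of closed balls of radius $r>0$ needed to cover the bounded set $A$. Assouad spectrum: for $X \subseteq \mathbb{R}^m$ and $\theta \in (0,1)$, $\dim_{\mathrm{A}}^\theta X$ is the infimum of all $\alpha \geq 0$ for which there exists a constant $C>0$ such that $N_{R^{1/\theta}}(X \cap B(x,R)) \leq C (R/R^{1/\theta})^\alpha$ for all $0<R<1$ and all $x \in X$. Capacity: for $0 \leq s \leq d$ and $r>0$ let $\phi_r^s(x) = \min\{1, (r/|x|)^s\}$ for $x \in \mathbb{R}^d$ (with $\phi_r^s(0)=1$). For non-empty compact $E \subseteq \mathbb{R}^d$ the capacity $C_r^s(E)$ is defined by $$C_r^s(E)^{-1} = \inf_{\mu \in \mathcal{M}(E)} \iint \phi_r^s(x-y)\,d\mu(x)\,d\mu(y),$$ where $\mathcal{M}(E)$ is the set of Borel probability measures supported by $E$. The capacity of a non-empty bounded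 set is the capacity of its closure. Assouad spectrum profile: for an integer $1 \leq k<d$, $\dim_{\mathrm{A}}^{\theta,k} X$ is the infimum of all $\alpha \geq 0$ for which there exists a constant $C>0$ such that $C_{R^{1/\theta}}^k(X \cap B(x,R)) \leq C (R/R^{1/\theta})^\alpha$ for all $0<R<1$ and all $x \in X$. *)

theory Defs
  imports "HOL-Analysis.Analysis" "HOL-Probability.Probability"
begin

section \<open>Orthogonal projections and the Grassmannian\<close>

definition orth_proj :: "'a::euclidean_space set \<Rightarrow> 'a \<Rightarrow> 'a" where
  "orth_proj V x = (THE y. y \<in> V \<and> (\<forall>v\<in>V. orthogonal (x - y) v))"

lemma orth_proj_unique:
  assumes V: "subspace V"
    and y: "y \<in> V" "\<And>v. v \<in> V \<Longrightarrow> orthogonal (x - y) v"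
    and z: "z \<in> V" "\<And>v. v \<in> V \<Longrightarrow> orthogonal (x - z) v"
  shows "y = z"
proof -
  have d: "y - z \<in> V"
    using V y z by (simp add: subspace_diff)
  have "(y - z) \<bullet> (y - z) = (x - z) \<bullet> (y - z) - (x - y) \<bullet> (y - z)"
    by (simp add: inner_diff_left)
  also have "\<dots> = 0"
    using y(2)[OF d] z(2)[OF d] by (simp add: orthogonal_def)
  finally show ?thesis by simp
qed

lemma orth_proj_props:
  assumes V: "subspace V"
  shows "orth_proj V x \<in> V" "v \<in> V \<Longrightarrow> orthogonal (x - orth_proj V x) v"
proof -
  obtain y z where y: "y \<in> span V" and z: "\<And>w. w \<in> span V \<Longrightarrow> orthogonal z w" and x: "x = y + z"
    using orthogonal_subspace_decomp_exists[of V x] by blast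
  have "\<exists>!y. y \<in> V \<and> (\<forall>v\<in>V. orthogonal (x - y) v)"
  proof (rule ex1I[of _ y])
    show "y \<in> V \<and> (\<forall>v\<in>V. orthogonal (x - y) v)"
      using y z x span_eq_iff[THEN iffD2, OF V] by simp
    then show "w = y" if "w \<in> V \<and> (\<forall>v\<in>V. orthogonal (x - w) v)" for w
      using that orth_proj_unique[OF V, of w x y] by blast
  qed
  from theI'[OF this] 
  show "orth_proj V x \<in> V" "v \<in> V \<Longrightarrow> orthogonal (x - orth_proj V x) v"
    unfolding orth_proj_def by auto
qed

lemma orth_proj_eqI:
  assumes "subspace V" "y \<in> V" "\<And>v. v \<in> V \<Longrightarrow> orthogonal (x - y) v"
  shows "orth_proj V x = y"
  by (rule orth_proj_unique[OF assms(1) orth_proj_props[OF assms(1)] assms(2,3)])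

lemma orth_proj_id: "subspace V \<Longrightarrow> x \<in> V \<Longrightarrow> orth_proj V x = x"
  by (rule orth_proj_eqI) (auto simp: orthogonal_def)

lemma linear_orth_proj:
  assumes V: "subspace V"
  shows "linear (orth_proj V)"
proof (rule linearI)
  fix x y :: 'a and c :: real
  note P = orth_proj_props[OF V, unfolded orthogonal_def]
  show "orth_proj V (x + y) = orth_proj V x + orth_proj V y"
  proof (rule orth_proj_eqI[OF V])
    fix v assume "v \<in> V"
    then show "orthogonal (x + y - (orth_proj V x + orth_proj V y)) v"
      using P(2)[of v x] P(2)[of v y]
      by (simp add: orthogonal_def inner_diff_left inner_add_left)
  qed (use V P in \<open>auto intro: subspace_add\<close>)
  show "orth_proj V (c *\<^sub>R x) = c *\<^sub>R orth_proj V x"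
  proof (rule orth_proj_eqI[OF V])
    fix v assume "v \<in> V"
    then show "orthogonal (c *\<^sub>R x - c *\<^sub>R orth_proj V x) v"
      using P(2)[of v x]
      by (simp add: orthogonal_def inner_diff_left)
  qed (use V P in \<open>auto intro: subspace_scale\<close>)
qed

lemma bounded_linear_orth_proj: "subspace V \<Longrightarrow> bounded_linear (orth_proj V)"
  using linear_orth_proj linear_conv_bounded_linear by blast

definition grassmannian :: "nat \<Rightarrow> 'a::euclidean_space set set" where
  "grassmannian k = {V. subspace V \<and> dim V = k}"

text \<open>The usual metric on the Grassmannian: the operator norm of \<open>P_V - P_W\<close>.\<close>

definition grass_dist :: "'a::euclidean_space set \<Rightarrow> 'a set \<Rightarrow> real" where
  "grass_dist V W = norm (Blinfun (orth_proj V) - Blinfun (orth_proj W))"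

lemma Metric_space_grassmannian: "Metric_space (grassmannian k) grass_dist"
proof
  fix V W U :: "'a set"
  show "0 \<le> grass_dist V W" "grass_dist V W = grass_dist W V"
    by (simp_all add: grass_dist_def norm_minus_commute)
  show "grass_dist V U \<le> grass_dist V W + grass_dist W U"
    unfolding grass_dist_def dist_norm[symmetric] by (rule dist_triangle)
  assume "V \<in> grassmannian k" "W \<in> grassmannian k"
  then have V: "subspace V" and W: "subspace W"
    by (simp_all add: grassmannian_def)
  show "grass_dist V W = 0 \<longleftrightarrow> V = W"
  proof
    assume "grass_dist V W = 0"
    then have "Blinfun (orth_proj V) = Blinfun (orth_proj W)"
      by (simp add: grass_dist_def)
    then have "blinfun_apply (Blinfun (orth_proj V)) = blinfun_apply (Blinfun (orth_proj W))"
      by (rule arg_cong)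
    then have eq: "orth_proj V = orth_proj W"
      unfolding bounded_linear_Blinfun_apply[OF bounded_linear_orth_proj[OF V]]
        bounded_linear_Blinfun_apply[OF bounded_linear_orth_proj[OF W]] .
    have "V \<subseteq> W"
    proof
      fix x assume "x \<in> V"
      then show "x \<in> W"
        using orth_proj_id[OF V, of x] orth_proj_props(1)[OF W, of x] eq by simp
    qed
    moreover have "W \<subseteq> V"
    proof
      fix x assume "x \<in> W"
      then show "x \<in> V"
        using orth_proj_id[OF W, of x] orth_proj_props(1)[OF V, of x] eq by simp
    qed
    ultimately show "V = W" ..
  qed (simp add: grass_dist_def)
qed

text \<open>The following predicate characterises the measure \<open>\<gamma>\<^bsub>d,k\<^esub>\<close> uniquely.\<close>

definition grassmannian_measure :: "nat \<Rightarrow> (real^'n) set measure \<Rightarrow> bool" where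
  "grassmannian_measure k \<gamma> \<longleftrightarrow>
     space \<gamma> = grassmannian k \<and>
     sets \<gamma> = sigma_sets (grassmannian k)
                {U. openin (Metric_space.mtopology (grassmannian k) grass_dist) U} \<and>
     prob_space \<gamma> \<and>
     (\<forall>Q. rotation_matrix Q \<longrightarrow>
        (\<forall>\<A>\<in>sets \<gamma>. emeasure \<gamma> ((\<lambda>V. (*v) Q ` V) ` \<A>) = emeasure \<gamma> \<A>))"

section \<open>Assouad spectrum\<close>

text \<open>
  The first argument \<open>S\<close> of the next two constants is the ambient Euclidean space in which the
  covering balls live: \<open>S = UNIV\<close> for subsets of the whole space, and \<open>S = V\<close> for subsets of a
  linear subspace \<open>V\<close> which is identified with \<open>\<real>\<^sup>k\<close>; for centres \<open>c \<in> V\<close> the ball of \<open>V\<close>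
  with centre \<open>c\<close> is \<open>cball c r \<inter> V\<close>.
\<close>

definition covering_number :: "'a::euclidean_space set \<Rightarrow> real \<Rightarrow> 'a set \<Rightarrow> nat" where
  "covering_number S r A =
     (LEAST n. \<exists>F. F \<subseteq> S \<and> finite F \<and> card F = n \<and> A \<subseteq> (\<Union>c\<in>F. cball c r))"

definition assouad_spectrum :: "'a::euclidean_space set \<Rightarrow> real \<Rightarrow> 'a set \<Rightarrow> real" where
  "assouad_spectrum S \<theta> X =
     Inf {\<alpha>. 0 \<le> \<alpha> \<and> (\<exists>C>0. \<forall>R x. 0 < R \<and> R < 1 \<and> x \<in> X \<longrightarrow>
            real (covering_number S (R powr (1 / \<theta>)) (X \<inter> cball x R))
              \<le> C * (R / R powr (1 / \<theta>)) powr \<alpha>)}"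

section \<open>Capacities and the Assouad spectrum profile\<close>

definition cap_kernel :: "real \<Rightarrow> real \<Rightarrow> 'a::euclidean_space \<Rightarrow> real" where
  "cap_kernel s r x = (if x = 0 then 1 else min 1 ((r / norm x) powr s))"

definition prob_measures_on :: "'a::euclidean_space set \<Rightarrow> 'a measure set" where
  "prob_measures_on E = {\<mu>. sets \<mu> = sets borel \<and> prob_space \<mu> \<and> emeasure \<mu> (- E) = 0}"

definition compact_capacity :: "real \<Rightarrow> real \<Rightarrow> 'a::euclidean_space set \<Rightarrow> real" where
  "compact_capacity s r E =
     inverse (INF \<mu>\<in>prob_measures_on E. LINT y|\<mu>. LINT x|\<mu>. cap_kernel s r (x - y))"

definition capacity :: "real \<Rightarrow> real \<Rightarrow> 'a::euclidean_space set \<Rightarrow> real" where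
  "capacity s r A = compact_capacity s r (closure A)"

definition assouad_spectrum_profile :: "real \<Rightarrow> nat \<Rightarrow> 'a::euclidean_space set \<Rightarrow> real" where
  "assouad_spectrum_profile \<theta> k X =
     Inf {\<alpha>. 0 \<le> \<alpha> \<and> (\<exists>C>0. \<forall>R x. 0 < R \<and> R < 1 \<and> x \<in> X \<longrightarrow>
            capacity (real k) (R powr (1 / \<theta>)) (X \<inter> cball x R)
              \<le> C * (R / R powr (1 / \<theta>)) powr \<alpha>)}"

end

(*
  Let mu be a probability measure on the closure of a bounded set E. If N balls of radius r cover
  P_V E, then Cauchy-Schwarz gives 1/N <= (mu x mu){|P_V(x - y)| <= 2r}. Averaging over V, Fubini and
  the estimate gamma{|P_V z| <= 2r} <= c phi_r^k(z) bound the mean of the right-hand side by c times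
  the energy of mu, so by Markov's inequality few balls cover P_V E only for a set of V of measure at
  most c N / C_r^k(E). If alpha is smaller than the profile, then for every m some
  piece E of X in a ball of radius R has C_r^k(E) > m (R/r)^alpha, where r = R^(1/theta). Hence the V
  for which N_r <= M (R/r)^alpha for all pieces of P_V X in balls of radius R form a null set.
*)
theory Submission
  imports Defs
begin

section \<open>Orthogonal projections\<close>

text \<open>Since X is arbitrary, measurability of the set of V whose projections are covered by few
  balls is never claimed. Each estimate is made for a measurable superset, defined through the
  correlation integral of mu alone. For a fixed constant M one badly covered piece already excludes
  V, so one piece for each m suffices. The factor (R/r)^alpha occurs both in the permitted number of
  balls and in the capacity and cancels, which leaves a bound of order M/(m+1) that does not depend
  on the scale of the piece. Letting m grow with M fixed gives a null set. The null set depends on M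
  and on the exponent. Monotonicity in both reduces them to natural and rational values, so that
  only countably many null sets are discarded.\<close>

lemma norm_orth_proj_le:
  assumes "subspace V"
  shows "norm (orth_proj V x) \<le> norm x"
proof -
  have "orthogonal (orth_proj V x) (x - orth_proj V x)"
    using orth_proj_props[OF assms] by (metis orthogonal_commute)
  from norm_add_Pythagorean[OF this] have "(norm x)\<^sup>2 = (norm (orth_proj V x))\<^sup>2 + (norm (x - orth_proj V x))\<^sup>2"
    by simp
  then show ?thesis
    by (metis le_add_same_cancel1 norm_ge_zero power2_le_imp_le zero_le_power2)
qed

lemma norm_orth_proj_diff_le:
  assumes "subspace V" "subspace W"
  shows "norm (orth_proj V x - orth_proj W x) \<le> grass_dist V W * norm x"
proof -
  have "orth_proj V x - orth_proj W x = blinfun_apply (Blinfun (orth_proj V) - Blinfun (orth_proj W)) x"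
    by (simp add: blinfun.diff_left bounded_linear_Blinfun_apply bounded_linear_orth_proj assms)
  then show ?thesis
    unfolding grass_dist_def by (metis norm_blinfun)
qed

text \<open>This transfers a rotation from the subspace, where invariance of the measure applies, to
  the projected vector.\<close>

lemma orth_proj_orthogonal_transformation:
  assumes f: "orthogonal_transformation f" and V: "subspace V"
  shows "orth_proj (f ` V) (f x) = f (orth_proj V x)"
proof (rule orth_proj_eqI)
  have lin: "linear f"
    using f by (rule orthogonal_transformation_linear)
  show "subspace (f ` V)"
    using lin V by (rule linear_subspace_image)
  show "f (orth_proj V x) \<in> f ` V"
    using orth_proj_props(1)[OF V] by blast
  show "orthogonal (f x - f (orth_proj V x)) w" if "w \<in> f ` V" for w
  proof -
    obtain v where "v \<in> V" "w = f v" using \<open>w \<in> f ` V\<close> by blast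
    then show ?thesis
      using orth_proj_props(2)[OF V, of v x] f
      by (simp add: orthogonal_def orthogonal_transformation_def linear_diff[OF lin, symmetric])
  qed
qed

lemma grassmannian_image:
  assumes f: "orthogonal_transformation f" and V: "V \<in> grassmannian k"
  shows "f ` V \<in> grassmannian k"
  using assms orthogonal_transformation_linear[OF f] orthogonal_transformation_inj[OF f]
  by (auto simp: grassmannian_def linear_subspace_image intro: dim_image_eq[THEN trans] inj_on_subset)

section \<open>Measurability of the projection in the subspace and the vector\<close>

lemma orth_proj_expansion:
  assumes "subspace V"
  shows "orth_proj V x = (\<Sum>b\<in>Basis. (x \<bullet> b) *\<^sub>R orth_proj V b)"
proof -
  have "orth_proj V x = orth_proj V (\<Sum>b\<in>Basis. (x \<bullet> b) *\<^sub>R b)"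
    by (simp add: euclidean_representation)
  also have "\<dots> = (\<Sum>b\<in>Basis. (x \<bullet> b) *\<^sub>R orth_proj V b)"
    by (simp add: linear_sum[OF linear_orth_proj[OF assms]] linear_scale[OF linear_orth_proj[OF assms]])
  finally show ?thesis .
qed

lemma space_grassmannian_measure:
  "grassmannian_measure k \<gamma> \<Longrightarrow> V \<in> space \<gamma> \<longleftrightarrow> subspace V \<and> dim V = k"
  by (simp add: grassmannian_measure_def grassmannian_def)

lemma borel_measurable_orth_proj_fixed:
  fixes x :: "real^'n"
  assumes \<gamma>: "grassmannian_measure k \<gamma>"
  shows "(\<lambda>V. orth_proj V x) \<in> borel_measurable \<gamma>"
proof (rule borel_measurableI)
  fix S :: "(real^'n) set" assume S: "open S"
  interpret G: Metric_space "grassmannian k" grass_dist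
    by (rule Metric_space_grassmannian)
  let ?U = "(\<lambda>V. orth_proj V x) -` S \<inter> grassmannian k"
  have "openin G.mtopology ?U"
    unfolding G.openin_mtopology
  proof (intro conjI allI impI)
    fix V assume V: "V \<in> ?U"
    then obtain e where e: "e > 0" "\<And>y. dist (orth_proj V x) y < e \<Longrightarrow> y \<in> S"
      using S by (force simp: open_contains_ball)
    \<comment> \<open>For fixed x the map to \<open>orth_proj V x\<close> is Lipschitz with constant
      \<open>norm x\<close>; the added 1 keeps the radius meaningful when x = 0.\<close>
    have "G.mball V (e / (norm x + 1)) \<subseteq> ?U"
    proof
      fix W assume W: "W \<in> G.mball V (e / (norm x + 1))"
      have "dist (orth_proj V x) (orth_proj W x) \<le> grass_dist V W * norm x"
        using norm_orth_proj_diff_le[of V W x] V W unfolding G.in_mball by (simp add: grassmannian_def dist_norm)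
      also have "\<dots> \<le> grass_dist V W * (norm x + 1)"
        by (simp add: mult_left_mono grass_dist_def)
      also have "\<dots> < e"
        using W by (simp add: pos_less_divide_eq add_nonneg_pos)
      finally show "W \<in> ?U"
        using e W by auto
    qed
    then show "\<exists>r>0. G.mball V r \<subseteq> ?U"
      using \<open>e > 0\<close> by (intro exI[of _ "e / (norm x + 1)"]) (auto simp: add_nonneg_pos)
  qed auto
  then show "(\<lambda>V. orth_proj V x) -` S \<inter> space \<gamma> \<in> sets \<gamma>"
    using \<gamma> unfolding grassmannian_measure_def by (auto intro: sigma_sets.Basic)
qed

text \<open>Expansion in the standard basis separates the variables: each summand is a coordinate of
  the vector times the projection of a fixed basis vector, so measurability for fixed vectors gives
  joint measurability, as Fubini requires.\<close>

lemma borel_measurable_orth_proj: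
  assumes \<gamma>: "grassmannian_measure k \<gamma>" and f: "f \<in> measurable M \<gamma>" and g: "g \<in> borel_measurable M"
  shows "(\<lambda>w. orth_proj (f w) (g w)) \<in> borel_measurable M"
proof -
  have [measurable]: "(\<lambda>w. orth_proj (f w) b) \<in> borel_measurable M" for b
    using measurable_compose[OF f borel_measurable_orth_proj_fixed[OF \<gamma>]] .
  note g[measurable]
  have "(\<lambda>w. \<Sum>b\<in>Basis. (g w \<bullet> b) *\<^sub>R orth_proj (f w) b) \<in> borel_measurable M"
    by measurable
  also have "?this \<longleftrightarrow> ?thesis"
  proof (rule measurable_cong)
    fix w assume "w \<in> space M"
    then have "subspace (f w)"
      using measurable_space[OF f] space_grassmannian_measure[OF \<gamma>] by blast
    then show "(\<Sum>b\<in>Basis. (g w \<bullet> b) *\<^sub>R orth_proj (f w) b) = orth_proj (f w) (g w)"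
      by (rule orth_proj_expansion[symmetric])
  qed
  finally show ?thesis .
qed

lemma borel_measurable_orth_proj_subspace:
  "subspace V \<Longrightarrow> orth_proj V \<in> borel_measurable borel"
  by (intro borel_measurable_continuous_onI linear_continuous_on bounded_linear_orth_proj)

section \<open>Measure of the subspaces that nearly annihilate a vector\<close>

lemma compact_slab:
  fixes V :: "'a::euclidean_space set"
  assumes V: "subspace V"
  shows "compact {z \<in> cball 0 1. norm (orth_proj V z) \<le> \<rho>}"
proof -
  have "continuous_on UNIV (\<lambda>z. norm (orth_proj V z))"
    using bounded_linear_orth_proj[OF V] by (intro continuous_on_norm linear_continuous_on)
  then have "closed {z. norm (orth_proj V z) \<le> \<rho>}"
    by (intro closed_Collect_le) auto
  then have "compact (cball 0 1 \<inter> {z. norm (orth_proj V z) \<le> \<rho>})"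
    by (intro compact_Int_closed compact_cball)
  then show ?thesis
    by (simp add: Int_def)
qed

text \<open>
  About \<open>\<rho>\<^sup>-\<^sup>k\<close> translates of the slab by the points of a grid in \<open>V\<close> of mesh \<open>3\<rho>\<close> are disjoint and lie
  in a fixed ball.
\<close>

lemma measure_slab_le:
  fixes V :: "'a::euclidean_space set"
  assumes V: "subspace V" and \<rho>: "0 < \<rho>"
  shows "measure lebesgue {z \<in> cball 0 1. norm (orth_proj V z) \<le> \<rho>}
    \<le> (6 * \<rho>) ^ dim V * measure lebesgue (cball (0::'a) (1 + dim V))"
proof -
  let ?S = "{z \<in> cball 0 1. norm (orth_proj V z) \<le> \<rho>}"
  let ?L = "measure lebesgue (cball (0::'a) (1 + dim V))"
  have S: "?S \<in> lmeasurable"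
    using compact_slab[OF V] by (rule lmeasurable_compact)
  show ?thesis
  proof (cases "3 * \<rho> \<le> 1")
    \<comment> \<open>For large \<rho> the factor \<open>6 * \<rho>\<close> exceeds 1, and the
      volume of the ball is already a bound.\<close>
    case False
    have "measure lebesgue ?S \<le> ?L"
      using S by (intro measure_mono_fmeasurable) auto
    also have "\<dots> \<le> (6 * \<rho>) ^ dim V * ?L"
      using False mult_right_mono[OF one_le_power[of "6 * \<rho>" "dim V"], of ?L] by simp
    finally show ?thesis .
  next
    case True
    \<comment> \<open>m is the number of grid points in each direction:
      \<open>3 * \<rho> * m \<le> 1\<close> keeps the grid bounded, while
      \<open>6 * \<rho> * m \<ge> 1\<close>, which follows from m \<ge> 1, says that rounding down
      loses at most a factor 2.\<close>
    define m where "m = nat \<lfloor>1 / (3 * \<rho>)\<rfloor>"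
    have x1: "1 \<le> 1 / (3 * \<rho>)"
      using True \<rho> by simp
    then have "real m = of_int \<lfloor>1 / (3 * \<rho>)\<rfloor>"
      unfolding m_def by (intro of_nat_nat) linarith
    then have "real m \<le> 1 / (3 * \<rho>)" "1 / (3 * \<rho>) < real m + 1"
      by linarith+
    then have m: "3 * \<rho> * real m \<le> 1" and m': "1 < 3 * \<rho> * real m + 3 * \<rho>"
      using \<rho> by (simp_all add: field_simps)
    have "1 \<le> m"
      using x1 unfolding m_def by (metis le_nat_floor of_nat_1)
    then have "\<rho> * 1 \<le> \<rho> * real m"
      using \<rho> by (intro mult_left_mono) auto
    with m' have m'': "1 \<le> 6 * \<rho> * real m"
      by linarith
    obtain B where B: "B \<subseteq> V" "pairwise orthogonal B" "\<And>x. x \<in> B \<Longrightarrow> norm x = 1"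
        "independent B" "card B = dim V"
      using orthonormal_basis_subspace[OF V] by metis
    have finB: "finite B"
      using B(4) by (rule independent_imp_finite)
    define N where "N = (B \<rightarrow>\<^sub>E {..<m})"
    define p where "p n = (\<Sum>b\<in>B. (3 * \<rho> * real (n b)) *\<^sub>R b)" for n :: "'a \<Rightarrow> nat"
    have finN: "finite N" and cardN: "card N = m ^ dim V"
      using finB by (simp_all add: N_def finite_PiE card_PiE B(5))
    have pb: "p n \<bullet> b = 3 * \<rho> * real (n b)" if "b \<in> B" for n b
    proof -
      have "p n \<bullet> b = (\<Sum>c\<in>B. (3 * \<rho> * real (n c)) * (c \<bullet> b))"
        by (simp add: p_def inner_sum_left)
      also have "\<dots> = (\<Sum>c\<in>B. if c = b then 3 * \<rho> * real (n b) else 0)"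
        using B(2,3) that by (intro sum.cong) (auto simp: pairwise_def orthogonal_def norm_eq_1)
      finally show ?thesis
        using finB that by simp
    qed
    have "norm (p n) \<le> dim V" if "n \<in> N" for n
    proof -
      have "norm (p n) \<le> (\<Sum>b\<in>B. 1)"
        unfolding p_def
      proof (rule sum_norm_le)
        fix b assume "b \<in> B"
        then have "n b < m" using that by (auto simp: N_def PiE_def)
        then have "3 * \<rho> * real (n b) \<le> 3 * \<rho> * real m"
          using \<rho> by (intro mult_left_mono) auto
        also note m
        finally show "norm ((3 * \<rho> * real (n b)) *\<^sub>R b) \<le> 1"
          using \<rho> B(3)[OF \<open>b \<in> B\<close>] by simp
      qed
      then show ?thesis using B(5) by simp
    qed
    then have "(\<Union>n\<in>N. (+) (p n) ` ?S) \<subseteq> cball 0 (1 + dim V)"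
      by (force intro: norm_triangle_le)
    moreover have meas: "(+) (p n) ` ?S \<in> lmeasurable" for n
      using S by (rule measurable_translation)
    ultimately have "measure lebesgue (\<Union>n\<in>N. (+) (p n) ` ?S) \<le> ?L"
      using finN by (intro measure_mono_fmeasurable sets.finite_UN) auto
    also have "measure lebesgue (\<Union>n\<in>N. (+) (p n) ` ?S) = (\<Sum>n\<in>N. measure lebesgue ((+) (p n) ` ?S))"
    proof (rule measure_UNION')
      show "pairwise (\<lambda>i j. disjnt ((+) (p i) ` ?S) ((+) (p j) ` ?S)) N"
      proof (rule pairwiseI, rule ccontr)
        fix i j assume ij: "i \<in> N" "j \<in> N" "i \<noteq> j" "\<not> disjnt ((+) (p i) ` ?S) ((+) (p j) ` ?S)"
        then obtain s t where st: "s \<in> ?S" "t \<in> ?S" "p i + s = p j + t"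
          by (auto simp: disjnt_def)
        obtain b where b: "b \<in> B" "i b \<noteq> j b"
          using ij(1-3) unfolding N_def by (metis PiE_ext)
        \<comment> \<open>On the slab every coordinate along b lies between -\<rho> and \<rho>, so
          two of its points differ there by at most \<open>2 * \<rho>\<close>. Grid points with
          different b-indices differ by at least \<open>3 * \<rho>\<close>, so their translates
          cannot meet.\<close>
        have P: "\<bar>u \<bullet> b\<bar> \<le> \<rho>" if "u \<in> ?S" for u
        proof -
          have "u \<bullet> b = orth_proj V u \<bullet> b"
            using orth_proj_props(2)[OF V, of b u] b(1) B(1) by (auto simp: orthogonal_def inner_diff_left)
          also have "\<bar>\<dots>\<bar> \<le> norm (orth_proj V u)"
            using Cauchy_Schwarz_ineq2[of "orth_proj V u" b] B(3)[OF b(1)] by simp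
          finally show ?thesis using that by simp
        qed
        have "3 * \<rho> * \<bar>real (i b) - real (j b)\<bar> = \<bar>3 * \<rho> * (real (i b) - real (j b))\<bar>"
          using \<rho> by (simp add: abs_mult)
        also have "3 * \<rho> * (real (i b) - real (j b)) = p i \<bullet> b - p j \<bullet> b"
          by (simp add: pb[OF b(1)] right_diff_distrib)
        also have "\<dots> = t \<bullet> b - s \<bullet> b"
          using arg_cong[OF st(3), of "\<lambda>v. v \<bullet> b"] by (simp add: inner_add_left)
        also have "\<bar>\<dots>\<bar> \<le> 2 * \<rho>"
          using P[OF st(1)] P[OF st(2)] by linarith
        finally have "3 * \<rho> * \<bar>real (i b) - real (j b)\<bar> \<le> 2 * \<rho>" .
        moreover have "1 \<le> \<bar>real (i b) - real (j b)\<bar>"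
          using b(2) by linarith
        then have "3 * \<rho> * 1 \<le> 3 * \<rho> * \<bar>real (i b) - real (j b)\<bar>"
          using \<rho> by (intro mult_left_mono) auto
        ultimately show False
          using \<rho> by linarith
      qed
    qed (use finN meas in auto)
    also have "\<dots> = real m ^ dim V * measure lebesgue ?S"
      by (simp add: measure_translation cardN)
    finally have *: "real m ^ dim V * measure lebesgue ?S \<le> ?L" .
    have "measure lebesgue ?S \<le> (6 * \<rho> * real m) ^ dim V * measure lebesgue ?S"
      using mult_right_mono[OF one_le_power[OF m'', of "dim V"], of "measure lebesgue ?S"] by simp
    also have "\<dots> = (6 * \<rho>) ^ dim V * (real m ^ dim V * measure lebesgue ?S)"
      by (simp add: power_mult_distrib)
    also have "\<dots> \<le> (6 * \<rho>) ^ dim V * ?L"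
      using * \<rho> by (intro mult_left_mono) auto
    finally show ?thesis .
  qed
qed

text \<open>A rotation taking u to w carries the first set of subspaces into the second. An
  inclusion is enough, because u and w may be exchanged. Dimension at least 2 supplies the rotation;
  on the line -1 is not one.\<close>

lemma grassmannian_measure_slab_mono:
  fixes \<gamma> :: "(real^'n) set measure"
  assumes "2 \<le> CARD('n)" and \<gamma>: "grassmannian_measure k \<gamma>" and uw: "norm u = norm w"
  shows "emeasure \<gamma> {V\<in>space \<gamma>. norm (orth_proj V u) \<le> t} \<le> emeasure \<gamma> {V\<in>space \<gamma>. norm (orth_proj V w) \<le> t}"
proof -
  obtain f where f: "orthogonal_transformation f" "det (matrix f) = 1" "f u = w"
    using rotation_exists[OF assms(1) uw] by blast
  have Q: "rotation_matrix (matrix f)" "(*v) (matrix f) = f"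
    using f orthogonal_transformation_matrix[of f] matrix_vector_mul(2)[of f]
    by (auto simp: rotation_matrix_def)
  have [measurable]: "(\<lambda>V. orth_proj V x) \<in> borel_measurable \<gamma>" for x
    by (rule borel_measurable_orth_proj_fixed[OF \<gamma>])
  let ?A = "\<lambda>x. {V\<in>space \<gamma>. norm (orth_proj V x) \<le> t}"
  have "?A u \<in> sets \<gamma>"
    by measurable
  moreover have "\<forall>\<A>\<in>sets \<gamma>. emeasure \<gamma> ((\<lambda>V. (*v) (matrix f) ` V) ` \<A>) = emeasure \<gamma> \<A>"
    using \<gamma> Q(1) unfolding grassmannian_measure_def by blast
  ultimately have "emeasure \<gamma> (?A u) = emeasure \<gamma> ((\<lambda>V. (*v) (matrix f) ` V) ` ?A u)"
    by simp
  also have "\<dots> \<le> emeasure \<gamma> (?A w)"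
  proof (rule emeasure_mono)
    have sp: "space \<gamma> = grassmannian k"
      using \<gamma> by (simp add: grassmannian_measure_def)
    show "(\<lambda>V. (*v) (matrix f) ` V) ` ?A u \<subseteq> ?A w"
      unfolding Q(2)
    proof safe
      fix V assume V: "V \<in> space \<gamma>" "norm (orth_proj V u) \<le> t"
      then show "f ` V \<in> space \<gamma>"
        using grassmannian_image[OF f(1)] sp by simp
      show "norm (orth_proj (f ` V) w) \<le> t"
        using orth_proj_orthogonal_transformation[OF f(1), of V u] V f(1,3) space_grassmannian_measure[OF \<gamma>]
        by (simp add: orthogonal_transformation_norm)
    qed
  qed simp
  finally show ?thesis .
qed

text \<open>
  By rotation invariance the left-hand side depends only on \<open>norm z\<close>, so it may be averaged over
  \<open>z\<close> in the unit ball, and Fubini reduces the claim to the volume of a single slab.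
\<close>

lemma grassmannian_measure_unit_slab_le:
  fixes \<gamma> :: "(real^'n) set measure"
  assumes card: "2 \<le> CARD('n)" and \<gamma>: "grassmannian_measure k \<gamma>" and u: "norm u = 1" and \<rho>: "0 < \<rho>"
  shows "measure \<gamma> {V\<in>space \<gamma>. norm (orth_proj V u) \<le> \<rho>} \<le> (1 + real k) ^ CARD('n) * (6 * \<rho>) ^ k"
proof -
  interpret prob_space \<gamma>
    using \<gamma> by (simp add: grassmannian_measure_def)
  interpret pair_sigma_finite \<gamma> "lborel :: (real^'n) measure"
    by unfold_locales
  let ?B = "cball (0::real^'n) 1"
  let ?L = "measure lebesgue ?B"
  let ?m = "emeasure \<gamma> {V\<in>space \<gamma>. norm (orth_proj V u) \<le> \<rho>}"
  have [measurable]: "(\<lambda>V. orth_proj V x) \<in> borel_measurable \<gamma>" for x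
    by (rule borel_measurable_orth_proj_fixed[OF \<gamma>])
  have [measurable]: "(\<lambda>w. orth_proj (fst w) (snd w)) \<in> borel_measurable (\<gamma> \<Otimes>\<^sub>M (lborel :: (real^'n) measure))"
    by (rule borel_measurable_orth_proj[OF \<gamma>]) simp_all
  define F where "F w = (if norm (snd w) \<le> 1 \<and> norm (orth_proj (fst w) (snd w)) \<le> \<rho> then 1 else 0 :: ennreal)"
    for w :: "(real^'n) set \<times> (real^'n)"
  have [measurable]: "F \<in> borel_measurable (\<gamma> \<Otimes>\<^sub>M lborel)"
    unfolding F_def by measurable
  have LB: "emeasure lborel ?B = ennreal ?L"
    by (simp add: emeasure_cball content_cball)
  have "?m * emeasure lborel ?B = (\<integral>\<^sup>+z. ?m * indicator ?B z \<partial>lborel)"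
    by (simp add: nn_integral_cmult_indicator)
  also have "\<dots> \<le> (\<integral>\<^sup>+z. (\<integral>\<^sup>+V. F (V, z) \<partial>\<gamma>) \<partial>lborel)"
  proof (rule nn_integral_mono)
    fix z :: "real^'n"
    show "?m * indicator ?B z \<le> (\<integral>\<^sup>+V. F (V, z) \<partial>\<gamma>)"
    proof (cases "z \<in> ?B")
      case True
      \<comment> \<open>Shrinking a vector shrinks its projection, so among the z in the unit ball
        the unit vectors give the smallest measure. Hence \<open>?m\<close> bounds the inner
        integral from below on the whole ball.\<close>
      have "?m \<le> emeasure \<gamma> {V\<in>space \<gamma>. norm (orth_proj V z) \<le> \<rho>}"
      proof (cases "z = 0")
        case True
        have "orth_proj V z = 0" if "V \<in> space \<gamma>" for V
          using that True space_grassmannian_measure[OF \<gamma>, of V] norm_orth_proj_le[of V z] by simp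
        then show ?thesis
          using \<rho> by (auto intro!: emeasure_mono)
      next
        case False
        have "?m \<le> emeasure \<gamma> {V\<in>space \<gamma>. norm (orth_proj V (z /\<^sub>R norm z)) \<le> \<rho>}"
          using False u by (intro grassmannian_measure_slab_mono[OF card \<gamma>]) simp
        also have "\<dots> \<le> emeasure \<gamma> {V\<in>space \<gamma>. norm (orth_proj V z) \<le> \<rho>}"
        proof (intro emeasure_mono subsetI)
          fix V assume V: "V \<in> {V\<in>space \<gamma>. norm (orth_proj V (z /\<^sub>R norm z)) \<le> \<rho>}"
          have "orth_proj V z = norm z *\<^sub>R orth_proj V (z /\<^sub>R norm z)"
            using V space_grassmannian_measure[OF \<gamma>, of V] False
            by (simp add: linear_scale[OF linear_orth_proj])
          then have "norm (orth_proj V z) = norm z * norm (orth_proj V (z /\<^sub>R norm z))"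
            by simp
          also have "\<dots> \<le> 1 * \<rho>"
            using True V by (intro mult_mono) auto
          finally show "V \<in> {V\<in>space \<gamma>. norm (orth_proj V z) \<le> \<rho>}"
            using V by simp
        qed simp
        finally show ?thesis .
      qed
      also have "\<dots> = (\<integral>\<^sup>+V. indicator {V\<in>space \<gamma>. norm (orth_proj V z) \<le> \<rho>} V \<partial>\<gamma>)"
        by simp
      also have "\<dots> = (\<integral>\<^sup>+V. F (V, z) \<partial>\<gamma>)"
        using True by (intro nn_integral_cong) (auto simp: F_def)
      finally show ?thesis using True by simp
    qed simp
  qed
  also have "\<dots> = (\<integral>\<^sup>+V. (\<integral>\<^sup>+z. F (V, z) \<partial>lborel) \<partial>\<gamma>)"
    by (rule Fubini) measurable
  also have "\<dots> \<le> (\<integral>\<^sup>+V. ennreal ((6 * \<rho>) ^ k * measure lebesgue (cball (0::real^'n) (1 + k))) \<partial>\<gamma>)"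
  proof (rule nn_integral_mono)
    fix V assume "V \<in> space \<gamma>"
    then have V: "subspace V" "dim V = k"
      using space_grassmannian_measure[OF \<gamma>] by auto
    let ?S = "{z \<in> ?B. norm (orth_proj V z) \<le> \<rho>}"
    have "?S \<in> sets lborel"
      using compact_slab[OF V(1)] by (simp add: borel_compact)
    have "(\<integral>\<^sup>+z. F (V, z) \<partial>lborel) = (\<integral>\<^sup>+z. indicator ?S z \<partial>lborel)"
      by (intro nn_integral_cong) (auto simp: F_def)
    also have "\<dots> = emeasure lborel ?S"
      using \<open>?S \<in> sets lborel\<close> by simp
    also have "\<dots> = emeasure lebesgue ?S"
      using \<open>?S \<in> sets lborel\<close> by (simp add: emeasure_completion)
    also have "\<dots> = ennreal (measure lebesgue ?S)"
      using lmeasurable_compact[OF compact_slab[OF V(1)]] by (rule emeasure_eq_measure2)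
    also have "\<dots> \<le> ennreal ((6 * \<rho>) ^ k * measure lebesgue (cball (0::real^'n) (1 + k)))"
      using measure_slab_le[OF V(1) \<rho>] V(2) by (intro ennreal_leI) simp
    finally show "(\<integral>\<^sup>+z. F (V, z) \<partial>lborel) \<le> ennreal ((6 * \<rho>) ^ k * measure lebesgue (cball (0::real^'n) (1 + k)))" .
  qed
  also have "\<dots> = ennreal ((6 * \<rho>) ^ k * measure lebesgue (cball (0::real^'n) (1 + k)))"
    by (simp add: emeasure_space_1)
  \<comment> \<open>Scaling of volume produces the constant \<open>(1 + k) ^ CARD('n)\<close>, and
    the volume of the unit ball cancels afterwards.\<close>
  also have "measure lebesgue (cball (0::real^'n) (1 + k)) = (1 + real k) ^ CARD('n) * ?L"
    by (simp add: content_cball)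
  finally have "ennreal (measure \<gamma> {V\<in>space \<gamma>. norm (orth_proj V u) \<le> \<rho>} * ?L)
      \<le> ennreal ((6 * \<rho>) ^ k * ((1 + real k) ^ CARD('n) * ?L))"
    by (simp add: LB emeasure_eq_measure ennreal_mult')
  then have "measure \<gamma> {V\<in>space \<gamma>. norm (orth_proj V u) \<le> \<rho>} * ?L
      \<le> ((1 + real k) ^ CARD('n) * (6 * \<rho>) ^ k) * ?L"
    using \<rho> by (simp add: ennreal_le_iff mult_ac)
  moreover have "?L > 0"
    by simp
  ultimately show ?thesis
    by (rule mult_right_le_imp_le)
qed

text \<open>One bound for each term of the minimum in the kernel: a probability is at most 1, hence
  at most c, and normalising z turns the width 2r into \<open>\<rho> = 2 * r / norm z\<close>, which
  is where 12 = 6 * 2 comes from.\<close>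

lemma grassmannian_measure_slab_le_kernel:
  fixes \<gamma> :: "(real^'n) set measure"
  assumes card: "2 \<le> CARD('n)" and \<gamma>: "grassmannian_measure k \<gamma>" and r: "0 < r"
  shows "measure \<gamma> {V\<in>space \<gamma>. norm (orth_proj V z) \<le> 2 * r}
    \<le> (1 + real k) ^ CARD('n) * 12 ^ k * cap_kernel (real k) r z"
proof -
  interpret prob_space \<gamma>
    using \<gamma> by (simp add: grassmannian_measure_def)
  define c where "c = (1 + real k) ^ CARD('n) * 12 ^ k"
  have c: "1 \<le> c"
    unfolding c_def using mult_mono[of 1 "(1 + real k) ^ CARD('n)" 1 "12 ^ k"] by (simp add: one_le_power)
  let ?m = "measure \<gamma> {V\<in>space \<gamma>. norm (orth_proj V z) \<le> 2 * r}"
  have m1: "?m \<le> c"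
    using c prob_le_1 order_trans by blast
  have "?m \<le> c * cap_kernel (real k) r z"
  proof (cases "z = 0")
    case True
    then show ?thesis using m1 by (simp add: cap_kernel_def)
  next
    case False
    have "{V\<in>space \<gamma>. norm (orth_proj V z) \<le> 2 * r}
        = {V\<in>space \<gamma>. norm (orth_proj V (z /\<^sub>R norm z)) \<le> 2 * r / norm z}"
      using False space_grassmannian_measure[OF \<gamma>]
      by (auto simp: linear_scale[OF linear_orth_proj] divide_inverse mult.commute)
    then have "?m \<le> (1 + real k) ^ CARD('n) * (6 * (2 * r / norm z)) ^ k"
      using grassmannian_measure_unit_slab_le[OF card \<gamma>, of "z /\<^sub>R norm z" "2 * r / norm z"] False r by simp
    also have "\<dots> = c * (r / norm z) ^ k"
      by (simp add: c_def power_mult_distrib[symmetric] mult.assoc)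
    also have "(r / norm z) ^ k = (r / norm z) powr real k"
      using False r by (simp add: powr_realpow)
    finally show ?thesis
      using m1 False c by (simp add: cap_kernel_def min_def)
  qed
  then show ?thesis by (simp add: c_def)
qed

section \<open>Capacities and covering numbers of projections\<close>

text \<open>
  A set covered by \<open>N\<close> balls splits into \<open>N\<close> pieces of masses \<open>p\<^sub>i\<close> and diameter at most \<open>2r\<close>, and
  the sum of the \<open>p\<^sub>i\<^sup>2\<close> is at least \<open>1/N\<close> by Cauchy-Schwarz.
\<close>

lemma (in prob_space) covering_correlation:
  fixes f :: "'a \<Rightarrow> 'b::euclidean_space"
  assumes f[measurable]: "f \<in> borel_measurable M" and F: "finite F"
    and cover: "AE x in M. f x \<in> (\<Union>c\<in>F. cball c r)"
  shows "1 \<le> of_nat (card F) * (\<integral>\<^sup>+y. emeasure M {x\<in>space M. norm (f x - f y) \<le> 2 * r} \<partial>M)"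
proof -
  let ?N = "card F"
  obtain g where g: "bij_betw g {0..<?N} F"
    using ex_bij_betw_nat_finite[OF F] by blast
  \<comment> \<open>The preimages of the balls may overlap; \<open>disjointed\<close> cuts them down
    to pieces whose masses add up to 1.\<close>
  define A where "A i = {x\<in>space M. dist (g i) (f x) \<le> r}" for i
  define D where "D = disjointed A"
  have [measurable]: "A i \<in> sets M" for i
    unfolding A_def by measurable
  have D[measurable]: "D i \<in> sets M" for i
    using sets.range_disjointed_sets[of A M] unfolding D_def by (auto simp: image_subset_iff)
  have DA: "D i \<subseteq> A i" for i
    unfolding D_def by (rule disjointed_subset)
  have disj: "disjoint_family D"
    unfolding D_def by (rule disjoint_family_disjointed)
  have "(\<Union>i\<in>{0..<?N}. D i) = (\<Union>i\<in>{0..<?N}. A i)"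
    unfolding D_def by (rule finite_UN_disjointed_eq)
  also have "\<dots> = {x\<in>space M. f x \<in> (\<Union>c\<in>g ` {0..<?N}. cball c r)}"
    unfolding A_def by auto
  also have "g ` {0..<?N} = F"
    using g by (rule bij_betw_imp_surj_on)
  finally have UN: "(\<Union>i\<in>{0..<?N}. D i) = {x\<in>space M. f x \<in> (\<Union>c\<in>F. cball c r)}" .
  have "AE x in M. x \<in> (\<Union>i\<in>{0..<?N}. D i)"
    unfolding UN using cover AE_space by eventually_elim simp
  moreover have "(\<Union>i\<in>{0..<?N}. D i) \<in> sets M"
    by measurable
  ultimately have "1 = prob (\<Union>i\<in>{0..<?N}. D i)"
    by (simp add: prob_eq_1)
  also have "\<dots> = (\<Sum>i\<in>{0..<?N}. prob (D i))"
    using disj by (intro finite_measure_finite_Union) (auto simp: disjoint_family_on_def)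
  finally have "1 \<le> (\<Sum>i\<in>{0..<?N}. (prob (D i))\<^sup>2) * ?N"
    using sum_squared_le_sum_of_squares[of "\<lambda>i. prob (D i)" "{0..<?N}"] by simp
  then have "1 \<le> ennreal (real ?N) * ennreal (\<Sum>i\<in>{0..<?N}. (prob (D i))\<^sup>2)"
    by (subst ennreal_mult'[symmetric]) (simp_all add: mult.commute flip: ennreal_1)
  also have "ennreal (\<Sum>i\<in>{0..<?N}. (prob (D i))\<^sup>2) = (\<Sum>i\<in>{0..<?N}. emeasure M (D i) * emeasure M (D i))"
    by (simp add: emeasure_eq_measure power2_eq_square flip: ennreal_mult')
  \<comment> \<open>The square of a mass is the integral of that mass over its own piece. If y lies
    in the piece \<open>D j\<close>, then all of \<open>D j\<close> lies within 2r of y after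
    applying f, by the triangle inequality through the common centre.\<close>
  also have "\<dots> = (\<integral>\<^sup>+y. (\<Sum>i\<in>{0..<?N}. emeasure M (D i) * indicator (D i) y) \<partial>M)"
    by (subst nn_integral_sum) (simp_all add: nn_integral_cmult_indicator)
  also have "\<dots> \<le> (\<integral>\<^sup>+y. emeasure M {x\<in>space M. norm (f x - f y) \<le> 2 * r} \<partial>M)"
  proof (rule nn_integral_mono)
    fix y
    show "(\<Sum>i\<in>{0..<?N}. emeasure M (D i) * indicator (D i) y) \<le> emeasure M {x\<in>space M. norm (f x - f y) \<le> 2 * r}"
    proof (cases "\<exists>j\<in>{0..<?N}. y \<in> D j")
      case True
      then obtain j where j: "j < ?N" "y \<in> D j" by auto
      have "(\<Sum>i\<in>{0..<?N}. emeasure M (D i) * indicator (D i) y) = (\<Sum>i\<in>{0..<?N}. if i = j then emeasure M (D j) else 0)"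
        using j disj by (intro sum.cong) (auto simp: disjoint_family_on_def indicator_def)
      also have "\<dots> = emeasure M (D j)"
        using j by simp
      also have "\<dots> \<le> emeasure M {x\<in>space M. norm (f x - f y) \<le> 2 * r}"
      proof (rule emeasure_mono)
        show "D j \<subseteq> {x\<in>space M. norm (f x - f y) \<le> 2 * r}"
        proof
          fix x assume "x \<in> D j"
          then have "x \<in> A j" "y \<in> A j" using DA j by auto
          then show "x \<in> {x\<in>space M. norm (f x - f y) \<le> 2 * r}"
            using dist_triangle2[of "f x" "f y" "g j"] by (simp add: A_def dist_commute flip: dist_norm)
        qed
      qed measurable
      finally show ?thesis .
    next
      case False
      then have "(\<Sum>i\<in>{0..<?N}. emeasure M (D i) * indicator (D i) y) = 0"
        by (intro sum.neutral) auto
      then show ?thesis by simp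
    qed
  qed
  finally show ?thesis
    by (simp add: mult_left_mono ennreal_of_nat_eq_real_of_nat)
qed

section \<open>Energies of the kernel, capacity, and the Markov bound\<close>

lemma cap_kernel_bounds:
  "0 \<le> cap_kernel s r x" "cap_kernel s r x \<le> 1"
  by (auto simp: cap_kernel_def)

lemma borel_measurable_cap_kernel[measurable]: "cap_kernel s r \<in> borel_measurable borel"
  unfolding cap_kernel_def[abs_def] by measurable

lemma integrable_cap_kernel:
  assumes "prob_space \<mu>" and sets[measurable_cong]: "sets \<mu> = sets borel"
  shows "integrable \<mu> (\<lambda>x. cap_kernel s r (x - y))"
    and "(\<lambda>y. LINT x|\<mu>. cap_kernel s r (x - y)) \<in> borel_measurable \<mu>"
    and "integrable \<mu> (\<lambda>y. LINT x|\<mu>. cap_kernel s r (x - y))"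
    and "0 \<le> (LINT x|\<mu>. cap_kernel s r (x - y))"
proof -
  interpret prob_space \<mu> by fact
  show int: "integrable \<mu> (\<lambda>x. cap_kernel s r (x - y))" for y
    by (rule integrable_const_bound[of _ 1]) (auto simp: cap_kernel_bounds)
  show m: "(\<lambda>y. LINT x|\<mu>. cap_kernel s r (x - y)) \<in> borel_measurable \<mu>"
    by measurable
  show nn: "0 \<le> (LINT x|\<mu>. cap_kernel s r (x - y))" for y
    by (simp add: cap_kernel_bounds)
  have "(LINT x|\<mu>. cap_kernel s r (x - y)) \<le> 1" for y
    by (rule integral_le_const[OF int]) (simp add: cap_kernel_bounds)
  then show "integrable \<mu> (\<lambda>y. LINT x|\<mu>. cap_kernel s r (x - y))"
    using m nn by (intro integrable_const_bound[of _ 1]) auto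
qed

text \<open>Capacity is defined by real-valued integrals, whereas Fubini and Markov are applied to
  nonnegative extended ones; this is the bridge.\<close>

lemma nn_integral_cap_kernel:
  assumes \<mu>: "prob_space \<mu>" "sets \<mu> = sets borel"
  shows "(\<integral>\<^sup>+y. \<integral>\<^sup>+x. ennreal (cap_kernel s r (x - y)) \<partial>\<mu> \<partial>\<mu>)
    = ennreal (LINT y|\<mu>. LINT x|\<mu>. cap_kernel s r (x - y))"
  using integrable_cap_kernel[OF \<mu>]
  by (simp add: nn_integral_eq_integral cap_kernel_bounds)

lemma return_prob_measures_on:
  "closed E \<Longrightarrow> x \<in> E \<Longrightarrow> return borel x \<in> prob_measures_on E"
  by (auto simp: prob_measures_on_def prob_space_return)

text \<open>The point x makes the class of measures non-empty through its Dirac mass, so the infimum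
  is a genuine one and can be approached.\<close>

lemma capacity_gt_obtain_measure:
  assumes "x \<in> A" and t: "0 < t" and cap: "t < capacity s r A"
  obtains \<mu> where "\<mu> \<in> prob_measures_on (closure A)"
    "(LINT y|\<mu>. LINT x|\<mu>. cap_kernel s r (x - y)) < 1 / t"
proof -
  let ?I = "\<lambda>\<mu>. LINT y|\<mu>. LINT x|\<mu>. cap_kernel s r (x - y)"
  let ?P = "prob_measures_on (closure A)"
  have ne: "?P \<noteq> {}"
    using assms(1) return_prob_measures_on[of "closure A" x] closure_subset by blast
  have "?I \<mu> \<ge> 0" if "\<mu> \<in> ?P" for \<mu>
    using that integrable_cap_kernel(4)[of \<mu>] by (auto simp: prob_measures_on_def)
  then have bdd: "bdd_below (?I ` ?P)"
    by (auto intro!: bdd_belowI[of _ 0])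
  have less: "t < inverse (INF \<mu>\<in>?P. ?I \<mu>)"
    using cap by (simp add: capacity_def compact_capacity_def)
  \<comment> \<open>As \<open>inverse 0 = 0\<close>, a positive capacity excludes a vanishing
    infimum.\<close>
  then have "0 < (INF \<mu>\<in>?P. ?I \<mu>)"
    using less_trans[OF t less] by simp
  then have "(INF \<mu>\<in>?P. ?I \<mu>) < 1 / t"
    using less t by (simp add: field_simps)
  then show thesis
    using that ne bdd by (auto simp: cINF_less_iff)
qed

text \<open>The measurable set B stands in for the set of subspaces of interest. The bound becomes
  small when T is small against the reciprocal of the energy of \<mu>.\<close>

lemma few_balls_cover_projection_bound:
  fixes \<gamma> :: "(real^'n) set measure"
  assumes card: "2 \<le> CARD('n)" and \<gamma>: "grassmannian_measure k \<gamma>" and r: "0 < r"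
    and \<mu>: "\<mu> \<in> prob_measures_on (closure E)" and T: "0 \<le> T"
  obtains B where "B \<in> sets \<gamma>"
    "{V\<in>space \<gamma>. \<exists>F. finite F \<and> real (card F) \<le> T \<and> orth_proj V ` E \<subseteq> (\<Union>c\<in>F. cball c r)} \<subseteq> B"
    "measure \<gamma> B \<le> T * ((1 + real k) ^ CARD('n) * 12 ^ k
       * (LINT y|\<mu>. LINT x|\<mu>. cap_kernel (real k) r (x - y)))"
proof -
  let ?c = "(1 + real k) ^ CARD('n) * 12 ^ k"
  have \<mu>': "prob_space \<mu>" "sets \<mu> = sets borel" "emeasure \<mu> (- closure E) = 0"
    using \<mu> by (auto simp: prob_measures_on_def)
  note \<mu>'(2)[measurable_cong]
  interpret \<gamma>: prob_space \<gamma>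
    using \<gamma> by (simp add: grassmannian_measure_def)
  interpret \<mu>: prob_space \<mu> by fact
  interpret \<gamma>\<mu>: pair_sigma_finite \<gamma> \<mu> by unfold_locales
  have sp: "space \<mu> = UNIV"
    using \<mu>'(2) by (metis sets_eq_imp_space_eq space_borel)
  have ae: "AE x in \<mu>. x \<in> closure E"
    using \<mu>' by (intro AE_I[of _ _ "- closure E"]) auto
  define F where "F V y x = (if norm (orth_proj V (x - y)) \<le> 2 * r then 1 else 0 :: ennreal)" for V and x y :: "real^'n"
  have Fm: "(\<lambda>w. F (fst w) (fst (snd w)) (snd (snd w))) \<in> borel_measurable (\<gamma> \<Otimes>\<^sub>M (\<mu> \<Otimes>\<^sub>M \<mu>))"
  proof -
    have "(\<lambda>w. orth_proj (fst w) (snd (snd w) - fst (snd w))) \<in> borel_measurable (\<gamma> \<Otimes>\<^sub>M (\<mu> \<Otimes>\<^sub>M \<mu>))"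
      by (rule borel_measurable_orth_proj[OF \<gamma>]) measurable
    then show ?thesis
      unfolding F_def by measurable
  qed
  have Fm': "(\<lambda>w. F (u w) (v w) (x w)) \<in> borel_measurable M"
    if "u \<in> measurable M \<gamma>" "v \<in> measurable M \<mu>" "x \<in> measurable M \<mu>" for u v x and M :: "'c measure"
    using measurable_compose[OF _ Fm, of "\<lambda>w. (u w, v w, x w)" M] that by simp
  \<comment> \<open>\<open>G V\<close> is the product measure of the pairs (x, y) whose projections
    to V are at distance at most 2r.\<close>
  define G where "G V = (\<integral>\<^sup>+y. \<integral>\<^sup>+x. F V y x \<partial>\<mu> \<partial>\<mu>)" for V
  have inner[measurable]: "(\<lambda>w. \<integral>\<^sup>+x. F (fst w) (snd w) x \<partial>\<mu>) \<in> borel_measurable (\<gamma> \<Otimes>\<^sub>M \<mu>)"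
    by (rule \<mu>.borel_measurable_nn_integral_fst[where f = "\<lambda>w. F (fst (fst w)) (snd (fst w)) (snd w)", simplified])
       (intro Fm'; measurable)
  have G[measurable]: "G \<in> borel_measurable \<gamma>"
    unfolding G_def using \<mu>.borel_measurable_nn_integral_fst[OF inner] by simp
  have "(\<integral>\<^sup>+V. G V \<partial>\<gamma>) = (\<integral>\<^sup>+y. \<integral>\<^sup>+V. \<integral>\<^sup>+x. F V y x \<partial>\<mu> \<partial>\<gamma> \<partial>\<mu>)"
    unfolding G_def using \<gamma>\<mu>.Fubini[OF inner] by simp
  also have "\<dots> = (\<integral>\<^sup>+y. \<integral>\<^sup>+x. \<integral>\<^sup>+V. F V y x \<partial>\<gamma> \<partial>\<mu> \<partial>\<mu>)"
  proof (rule nn_integral_cong)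
    fix y
    have "(\<lambda>w. F (fst w) y (snd w)) \<in> borel_measurable (\<gamma> \<Otimes>\<^sub>M \<mu>)"
      using sp by (intro Fm') auto
    from \<gamma>\<mu>.Fubini[OF this] show "(\<integral>\<^sup>+V. \<integral>\<^sup>+x. F V y x \<partial>\<mu> \<partial>\<gamma>) = (\<integral>\<^sup>+x. \<integral>\<^sup>+V. F V y x \<partial>\<gamma> \<partial>\<mu>)"
      by simp
  qed
  also have "\<dots> \<le> (\<integral>\<^sup>+y. \<integral>\<^sup>+x. ennreal ?c * ennreal (cap_kernel (real k) r (x - y)) \<partial>\<mu> \<partial>\<mu>)"
  proof (intro nn_integral_mono)
    fix y x
    have [measurable]: "(\<lambda>V. orth_proj V (x - y)) \<in> borel_measurable \<gamma>"
      by (rule borel_measurable_orth_proj_fixed[OF \<gamma>])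
    have "(\<integral>\<^sup>+V. F V y x \<partial>\<gamma>) = (\<integral>\<^sup>+V. indicator {V\<in>space \<gamma>. norm (orth_proj V (x - y)) \<le> 2 * r} V \<partial>\<gamma>)"
      by (intro nn_integral_cong) (auto simp: F_def)
    also have "\<dots> = ennreal (measure \<gamma> {V\<in>space \<gamma>. norm (orth_proj V (x - y)) \<le> 2 * r})"
      by (simp add: \<gamma>.emeasure_eq_measure)
    also have "\<dots> \<le> ennreal (?c * cap_kernel (real k) r (x - y))"
      by (intro ennreal_leI grassmannian_measure_slab_le_kernel card \<gamma> r)
    finally show "(\<integral>\<^sup>+V. F V y x \<partial>\<gamma>) \<le> ennreal ?c * ennreal (cap_kernel (real k) r (x - y))"
      by (simp add: ennreal_mult' cap_kernel_bounds)
  qed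
  also have "\<dots> = ennreal ?c * (\<integral>\<^sup>+y. \<integral>\<^sup>+x. ennreal (cap_kernel (real k) r (x - y)) \<partial>\<mu> \<partial>\<mu>)"
    by (simp add: nn_integral_cmult)
  also have "\<dots> = ennreal (?c * (LINT y|\<mu>. LINT x|\<mu>. cap_kernel (real k) r (x - y)))"
    by (simp add: nn_integral_cap_kernel[OF \<mu>'(1,2)] ennreal_mult')
  finally have GI: "(\<integral>\<^sup>+V. G V \<partial>\<gamma>) \<le> ennreal (?c * (LINT y|\<mu>. LINT x|\<mu>. cap_kernel (real k) r (x - y)))" .
  have I0: "0 \<le> (LINT y|\<mu>. LINT x|\<mu>. cap_kernel (real k) r (x - y))"
    using integrable_cap_kernel(4)[OF \<mu>'(1,2)] by simp
  \<comment> \<open>This is Markov's inequality at level 1/T, written without division so that T = 0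
    is included.\<close>
  let ?B = "{V\<in>space \<gamma>. 1 \<le> ennreal T * G V}"
  show thesis
  proof (rule that)
    show "?B \<in> sets \<gamma>" by measurable
    have "emeasure \<gamma> ?B \<le> ennreal T * (\<integral>\<^sup>+V. G V * indicator (space \<gamma>) V \<partial>\<gamma>)"
      by (rule nn_integral_Markov_inequality) auto
    also have "(\<integral>\<^sup>+V. G V * indicator (space \<gamma>) V \<partial>\<gamma>) = (\<integral>\<^sup>+V. G V \<partial>\<gamma>)"
      by (intro nn_integral_cong) auto
    also have "ennreal T * \<dots> \<le> ennreal T * ennreal (?c * (LINT y|\<mu>. LINT x|\<mu>. cap_kernel (real k) r (x - y)))"
      using GI by (rule mult_left_mono) simp
    finally show "measure \<gamma> ?B \<le> T * (?c * (LINT y|\<mu>. LINT x|\<mu>. cap_kernel (real k) r (x - y)))"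
      using T I0 by (simp add: \<gamma>.emeasure_eq_measure ennreal_le_iff flip: ennreal_mult')
    show "{V\<in>space \<gamma>. \<exists>F. finite F \<and> real (card F) \<le> T \<and> orth_proj V ` E \<subseteq> (\<Union>c\<in>F. cball c r)} \<subseteq> ?B"
    proof safe
      fix V C assume V: "V \<in> space \<gamma>" and C: "finite C" "real (card C) \<le> T" "orth_proj V ` E \<subseteq> (\<Union>c\<in>C. cball c r)"
      have sub: "subspace V"
        using V space_grassmannian_measure[OF \<gamma>] by blast
      have P: "orth_proj V \<in> borel_measurable \<mu>"
        using borel_measurable_orth_proj_subspace[OF sub] \<mu>'(2) by (simp cong: measurable_cong_sets)
      \<comment> \<open>A finite union of closed balls has closed preimage, so a cover of the
        projection of E also covers that of its closure, which carries \<mu>.\<close>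
      have "closed (\<Union>c\<in>C. cball c r)"
        using C(1) by (intro closed_UN) auto
      moreover have "continuous_on UNIV (orth_proj V)"
        using bounded_linear_orth_proj[OF sub] by (rule linear_continuous_on)
      ultimately have "closed (orth_proj V -` (\<Union>c\<in>C. cball c r))"
        by (metis continuous_closed_vimage continuous_on_eq_continuous_at open_UNIV UNIV_I)
      then have "closure E \<subseteq> orth_proj V -` (\<Union>c\<in>C. cball c r)"
        using C(3) unfolding image_subset_iff_subset_vimage by (intro closure_minimal)
      then have "AE x in \<mu>. orth_proj V x \<in> (\<Union>c\<in>C. cball c r)"
        using ae by (elim eventually_mono) blast
      from \<mu>.covering_correlation[OF P C(1) this]
      have "1 \<le> of_nat (card C) * (\<integral>\<^sup>+y. emeasure \<mu> {x\<in>space \<mu>. norm (orth_proj V x - orth_proj V y) \<le> 2 * r} \<partial>\<mu>)" .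
      also have "(\<integral>\<^sup>+y. emeasure \<mu> {x\<in>space \<mu>. norm (orth_proj V x - orth_proj V y) \<le> 2 * r} \<partial>\<mu>) = G V"
        unfolding G_def
      proof (rule nn_integral_cong)
        fix y
        let ?S = "{x\<in>space \<mu>. norm (orth_proj V x - orth_proj V y) \<le> 2 * r}"
        have "?S \<in> sets \<mu>"
          using P by measurable
        then have "emeasure \<mu> ?S = (\<integral>\<^sup>+x. indicator ?S x \<partial>\<mu>)"
          by simp
        also have "\<dots> = (\<integral>\<^sup>+x. F V y x \<partial>\<mu>)"
          by (intro nn_integral_cong) (auto simp: F_def linear_diff[OF linear_orth_proj[OF sub]])
        finally show "emeasure \<mu> ?S = (\<integral>\<^sup>+x. F V y x \<partial>\<mu>)" .
      qed
      also have "of_nat (card C) * G V \<le> ennreal T * G V"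
        using C(2) by (intro mult_right_mono) (auto simp: ennreal_of_nat_eq_real_of_nat ennreal_leI)
      finally show "1 \<le> ennreal T * G V" .
    qed
  qed
qed

section \<open>Covering numbers of bounded sets\<close>

text \<open>An r-separated subset of A with the most points covers A, and its points lie in S. The
  balls of radius r/2 about them are disjoint and lie in a ball of radius R + r/2 \<le> 3R/2;
  comparing volumes gives the bound. Existence of a finite cover also makes the \<open>LEAST\<close>
  in the definition an attained value.\<close>

lemma covering_number_props:
  fixes A :: "'a::euclidean_space set"
  assumes "A \<subseteq> S" and A: "A \<subseteq> cball x R" and r: "0 < r" "r \<le> R"
  shows covering_number_le: "real (covering_number S r A) \<le> (3 * R / r) ^ DIM('a)"
    and covering_number_attained: "\<exists>F\<subseteq>S. finite F \<and> card F = covering_number S r A \<and> A \<subseteq> (\<Union>c\<in>F. cball c r)"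
proof -
  define P where "P n \<longleftrightarrow> (\<exists>F\<subseteq>A. finite F \<and> card F = n \<and> pairwise (\<lambda>x y. r < dist x y) F)" for n
  have bound: "real n \<le> (3 * R / r) ^ DIM('a)" if "P n" for n
  proof -
    obtain F where F: "F \<subseteq> A" "finite F" "card F = n" "pairwise (\<lambda>x y. r < dist x y) F"
      using \<open>P n\<close> by (auto simp: P_def)
    let ?u = "unit_ball_vol (real DIM('a))"
    have "pairwise (\<lambda>x y. disjnt (cball x (r / 2)) (cball y (r / 2))) F"
      using F(4)
    proof (rule pairwise_mono)
      fix x y :: 'a assume "r < dist x y"
      then show "disjnt (cball x (r / 2)) (cball y (r / 2))"
        by (smt (verit) disjnt_iff dist_triangle2 dist_commute field_sum_of_halves mem_cball)
    qed simp
    then have "(\<Sum>x\<in>F. measure lebesgue (cball x (r / 2))) = measure lebesgue (\<Union>x\<in>F. cball x (r / 2))"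
      using F(2) by (intro measure_UNION'[symmetric]) auto
    also have "\<dots> \<le> measure lebesgue (cball x (3 * R / 2))"
    proof (rule measure_mono_fmeasurable)
      show "(\<Union>x\<in>F. cball x (r / 2)) \<subseteq> cball x (3 * R / 2)"
      proof safe
        fix y z assume yz: "y \<in> F" "z \<in> cball y (r / 2)"
        then have "dist x y \<le> R" "dist y z \<le> r / 2"
          using F(1) A by auto
        then show "z \<in> cball x (3 * R / 2)"
          using dist_triangle[of x z y] r by simp
      qed
    qed (use F(2) in auto)
    finally have "real n * (?u * (r / 2) ^ DIM('a)) \<le> ?u * (3 * R / 2) ^ DIM('a)"
      using r F(3) by (simp add: content_cball)
    moreover have "(3 * R / 2) ^ DIM('a) = (3 * R / r) ^ DIM('a) * (r / 2) ^ DIM('a)"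
      using r by (simp flip: power_mult_distrib)
    ultimately have "(?u * (r / 2) ^ DIM('a)) * real n \<le> (?u * (r / 2) ^ DIM('a)) * (3 * R / r) ^ DIM('a)"
      by (simp add: mult_ac)
    then show ?thesis
      using r by (simp add: unit_ball_vol_pos)
  qed
  have "P 0"
    unfolding P_def by (intro exI[of _ "{}"]) auto
  moreover have "n \<le> nat \<lceil>(3 * R / r) ^ DIM('a)\<rceil>" if "P n" for n
    using order_trans[OF bound[OF that] real_nat_ceiling_ge] by simp
  ultimately obtain n where n: "P n" "\<And>m. P m \<Longrightarrow> m \<le> n"
    using GreatestI_nat[of P 0] Greatest_le_nat[of P] by blast
  then obtain F where F: "F \<subseteq> A" "finite F" "card F = n" "pairwise (\<lambda>x y. r < dist x y) F"
    by (auto simp: P_def)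
  have AF: "A \<subseteq> (\<Union>c\<in>F. cball c r)"
  proof (rule ccontr)
    assume "\<not> ?thesis"
    then obtain y where y: "y \<in> A" "\<And>c. c \<in> F \<Longrightarrow> r < dist c y"
      by (force simp: not_le)
    then have "y \<notin> F" using r by force
    \<comment> \<open>An uncovered point is at distance more than r from all of F and could be added
      to it.\<close>
    have "P (Suc n)"
      unfolding P_def
      using y F \<open>y \<notin> F\<close> by (intro exI[of _ "insert y F"]) (auto simp: pairwise_insert dist_commute)
    then show False using n(2) by fastforce
  qed
  let ?Q = "\<lambda>n. \<exists>F. F \<subseteq> S \<and> finite F \<and> card F = n \<and> A \<subseteq> (\<Union>c\<in>F. cball c r)"
  have Q: "?Q n"
    using F AF \<open>A \<subseteq> S\<close> by blast
  show "\<exists>F\<subseteq>S. finite F \<and> card F = covering_number S r A \<and> A \<subseteq> (\<Union>c\<in>F. cball c r)"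
    unfolding covering_number_def using LeastI[of ?Q, OF Q] by blast
  have "covering_number S r A \<le> n"
    unfolding covering_number_def by (rule Least_le[of ?Q, OF Q])
  then show "real (covering_number S r A) \<le> (3 * R / r) ^ DIM('a)"
    using bound[OF n(1)] by linarith
qed

section \<open>Exponents of the Assouad spectrum of projections\<close>

lemma powr_inverse_le_self:
  fixes \<theta> R :: real
  assumes "0 < \<theta>" "\<theta> < 1" "0 < R" "R < 1"
  shows "R powr (1 / \<theta>) \<le> R"
  using powr_mono'[of 1 "1 / \<theta>" R] assms by simp

text \<open>A lower bound of all exponents passes to their real \<open>Inf\<close> only if there is
  an exponent at all; the dimension of the ambient space serves, although it is crude for subsets of
  V.\<close>

lemma assouad_spectrum_exponents_nonempty:
  fixes Y :: "'a::euclidean_space set"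
  assumes \<theta>: "0 < \<theta>" "\<theta> < 1" and Y: "Y \<subseteq> S"
  shows "\<exists>C>0. \<forall>R x. 0 < R \<and> R < 1 \<and> x \<in> Y \<longrightarrow>
    real (covering_number S (R powr (1 / \<theta>)) (Y \<inter> cball x R)) \<le> C * (R / R powr (1 / \<theta>)) powr real DIM('a)"
proof (intro exI[of _ "3 ^ DIM('a)"] conjI allI impI)
  fix R :: real and x assume R: "0 < R \<and> R < 1 \<and> x \<in> Y"
  have "real (covering_number S (R powr (1 / \<theta>)) (Y \<inter> cball x R)) \<le> (3 * R / R powr (1 / \<theta>)) ^ DIM('a)"
    using R Y \<theta> powr_inverse_le_self[OF \<theta>, of R] by (intro covering_number_le[where x = x]) auto
  also have "\<dots> = 3 ^ DIM('a) * (R / R powr (1 / \<theta>)) ^ DIM('a)"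
    by (simp flip: power_mult_distrib)
  finally show "real (covering_number S (R powr (1 / \<theta>)) (Y \<inter> cball x R))
      \<le> 3 ^ DIM('a) * (R / R powr (1 / \<theta>)) powr real DIM('a)"
    using R by (simp add: powr_realpow)
qed simp

lemma AE_not_spectrum_exponent:
  fixes X :: "(real^'n) set" and \<gamma> :: "(real^'n) set measure"
  assumes card: "2 \<le> CARD('n)" and \<theta>: "0 < \<theta>" "\<theta> < 1" and \<gamma>: "grassmannian_measure k \<gamma>"
    and not_profile: "\<not> (\<exists>C>0. \<forall>R x. 0 < R \<and> R < 1 \<and> x \<in> X \<longrightarrow>
      capacity (real k) (R powr (1 / \<theta>)) (X \<inter> cball x R) \<le> C * (R / R powr (1 / \<theta>)) powr \<alpha>)"
  shows "AE V in \<gamma>. \<not> (\<exists>C>0. \<forall>R x. 0 < R \<and> R < 1 \<and> x \<in> orth_proj V ` X \<longrightarrow>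
      real (covering_number V (R powr (1 / \<theta>)) (orth_proj V ` X \<inter> cball x R))
        \<le> C * (R / R powr (1 / \<theta>)) powr \<alpha>)"
proof -
  interpret prob_space \<gamma>
    using \<gamma> by (simp add: grassmannian_measure_def)
  define ok where "ok C V \<longleftrightarrow> (\<forall>R x. 0 < R \<and> R < 1 \<and> x \<in> orth_proj V ` X \<longrightarrow>
      real (covering_number V (R powr (1 / \<theta>)) (orth_proj V ` X \<inter> cball x R))
        \<le> C * (R / R powr (1 / \<theta>)) powr \<alpha>)" for C V
  define c where "c = (1 + real k) ^ CARD('n) * 12 ^ k"
  have "c > 0" by (simp add: c_def)
  \<comment> \<open>M is the constant in the covering bound and m measures how badly the capacity
    bound fails; \<open>Suc m\<close> is used because the constants refuted by
    \<open>not_profile\<close> are positive.\<close>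
  have step: "\<exists>B\<in>sets \<gamma>. {V\<in>space \<gamma>. ok (real M) V} \<subseteq> B \<and> measure \<gamma> B \<le> real M * c / real (Suc m)" for M m
  proof -
    obtain R x where R: "0 < R" "R < 1" "x \<in> X"
      and cap: "real (Suc m) * (R / R powr (1 / \<theta>)) powr \<alpha> < capacity (real k) (R powr (1 / \<theta>)) (X \<inter> cball x R)"
    proof -
      have "\<not> (\<forall>R x. 0 < R \<and> R < 1 \<and> x \<in> X \<longrightarrow> capacity (real k) (R powr (1 / \<theta>)) (X \<inter> cball x R)
          \<le> real (Suc m) * (R / R powr (1 / \<theta>)) powr \<alpha>)"
        using not_profile of_nat_0_less_iff[of "Suc m"] by blast
      then show thesis
        using that by (auto simp: not_le)
    qed
    let ?r = "R powr (1 / \<theta>)"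
    let ?D = "(R / ?r) powr \<alpha>"
    have D: "0 < ?D" using R by simp
    obtain \<mu> where \<mu>: "\<mu> \<in> prob_measures_on (closure (X \<inter> cball x R))"
        "(LINT y|\<mu>. LINT x|\<mu>. cap_kernel (real k) ?r (x - y)) < 1 / (real (Suc m) * ?D)"
      using capacity_gt_obtain_measure[OF _ _ cap, of x] R D by auto
    obtain B where B: "B \<in> sets \<gamma>"
      "{V\<in>space \<gamma>. \<exists>F. finite F \<and> real (card F) \<le> real M * ?D
          \<and> orth_proj V ` (X \<inter> cball x R) \<subseteq> (\<Union>c\<in>F. cball c ?r)} \<subseteq> B"
      "measure \<gamma> B \<le> real M * ?D * (c * (LINT y|\<mu>. LINT x|\<mu>. cap_kernel (real k) ?r (x - y)))"
      using few_balls_cover_projection_bound[OF card \<gamma> _ \<mu>(1), of ?r "real M * ?D"] R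
      unfolding c_def by auto
    have "{V\<in>space \<gamma>. ok (real M) V} \<subseteq> B"
    proof (intro subset_trans[OF _ B(2)] subsetI CollectI conjI)
      fix V assume V: "V \<in> {V\<in>space \<gamma>. ok (real M) V}"
      then show "V \<in> space \<gamma>" by simp
      have sub: "subspace V"
        using V space_grassmannian_measure[OF \<gamma>] by blast
      let ?A = "orth_proj V ` X \<inter> cball (orth_proj V x) R"
      have "real (covering_number V ?r ?A) \<le> real M * ?D"
        using V R by (auto simp: ok_def)
      moreover obtain F where "finite F" "card F = covering_number V ?r ?A" and F: "?A \<subseteq> (\<Union>c\<in>F. cball c ?r)"
        using covering_number_attained[of ?A V "orth_proj V x" R ?r] orth_proj_props(1)[OF sub]
          powr_inverse_le_self[OF \<theta> R(1,2)] R by auto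
      \<comment> \<open>Projection does not increase distances, so the image of the piece stays in a
        ball of the same radius R about \<open>orth_proj V x\<close>.\<close>
      moreover have "orth_proj V ` (X \<inter> cball x R) \<subseteq> ?A"
      proof (intro image_subsetI IntI imageI)
        fix y assume "y \<in> X \<inter> cball x R"
        then show "y \<in> X" by simp
        from \<open>y \<in> X \<inter> cball x R\<close> show "orth_proj V y \<in> cball (orth_proj V x) R"
          using norm_orth_proj_le[OF sub, of "x - y"]
          by (simp add: dist_norm linear_diff[OF linear_orth_proj[OF sub]])
      qed
      ultimately show "\<exists>F. finite F \<and> real (card F) \<le> real M * ?D
          \<and> orth_proj V ` (X \<inter> cball x R) \<subseteq> (\<Union>c\<in>F. cball c ?r)"
        by (intro exI[of _ F] conjI subset_trans[OF _ F]) simp_all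
    qed
    \<comment> \<open>The permitted number of balls is \<open>M * ?D\<close> and the energy is below
      \<open>1 / (Suc m * ?D)\<close>, so \<open>?D\<close> cancels.\<close>
    moreover have "measure \<gamma> B \<le> real M * ?D * (c * (1 / (real (Suc m) * ?D)))"
      using B(3) \<mu>(2) D \<open>c > 0\<close> by (elim order_trans) (intro mult_left_mono, auto)
    then have "measure \<gamma> B \<le> real M * c / real (Suc m)"
      using D by simp
    ultimately show ?thesis
      using B(1) by blast
  qed
  have "AE V in \<gamma>. \<not> ok (real M) V" for M
  proof -
    obtain B where B: "\<And>m. B m \<in> sets \<gamma>" "\<And>m. {V\<in>space \<gamma>. ok (real M) V} \<subseteq> B m"
        "\<And>m. measure \<gamma> (B m) \<le> real M * c / real (Suc m)"
      using step[of M] by metis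
    \<comment> \<open>All \<open>B m\<close> contain the same set of subspaces, so it lies in their
      intersection, whose measure is below every \<open>M * c / Suc m\<close>.\<close>
    have meas: "(\<Inter>m. B m) \<in> sets \<gamma>"
      using B(1) by blast
    have "measure \<gamma> (\<Inter>m. B m) \<le> real M * c / real (Suc m)" for m
      using B(1) by (intro order_trans[OF finite_measure_mono B(3)]) auto
    moreover have "(\<lambda>m. real M * c / real (Suc m)) \<longlonglongrightarrow> 0"
      using LIMSEQ_Suc[OF lim_const_over_n[of "real M * c"]] .
    ultimately have "measure \<gamma> (\<Inter>m. B m) \<le> 0"
      by (intro LIMSEQ_le_const) auto
    then have "(\<Inter>m. B m) \<in> null_sets \<gamma>"
      using meas by (auto simp: null_sets_def emeasure_eq_measure measure_le_0_iff)
    then show ?thesis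
      by (rule AE_I') (use B(2) in blast)
  qed
  then have "AE V in \<gamma>. \<forall>M. \<not> ok (real M) V"
    by (simp add: AE_all_countable)
  then show ?thesis
  proof eventually_elim
    case (elim V)
    have "\<not> ok C V" for C
    proof
      assume C: "ok C V"
      obtain M where "C \<le> real M" using real_arch_simple by blast
      with C have "ok (real M) V"
        unfolding ok_def by (meson mult_right_mono order_trans powr_ge_zero)
      then show False using elim by blast
    qed
    then show ?case
      by (auto simp: ok_def)
  qed
qed

theorem theorem2p1:
  fixes X :: "(real^'n) set" and \<theta> :: real and k :: nat
    and \<gamma> :: "(real^'n) set measure"
  assumes "2 \<le> CARD('n)"
    and "0 < \<theta>" and "\<theta> < 1"
    and "1 \<le> k" and "k < CARD('n)"
    and "grassmannian_measure k \<gamma>"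
  shows "AE V in \<gamma>. assouad_spectrum V \<theta> (orth_proj V ` X) \<ge> assouad_spectrum_profile \<theta> k X"
proof -
  note \<theta> = assms(2,3) and \<gamma> = assms(6)
  let ?s = "assouad_spectrum_profile \<theta> k X"
  define cap_ok where "cap_ok \<alpha> \<longleftrightarrow> (\<exists>C>0. \<forall>R x. 0 < R \<and> R < 1 \<and> x \<in> X \<longrightarrow>
      capacity (real k) (R powr (1 / \<theta>)) (X \<inter> cball x R) \<le> C * (R / R powr (1 / \<theta>)) powr \<alpha>)" for \<alpha>
  define cov_ok where "cov_ok V \<alpha> \<longleftrightarrow> (\<exists>C>0. \<forall>R x. 0 < R \<and> R < 1 \<and> x \<in> orth_proj V ` X \<longrightarrow>
      real (covering_number V (R powr (1 / \<theta>)) (orth_proj V ` X \<inter> cball x R))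
        \<le> C * (R / R powr (1 / \<theta>)) powr \<alpha>)" for V \<alpha>
  have s: "?s = Inf {\<alpha>. 0 \<le> \<alpha> \<and> cap_ok \<alpha>}"
    by (simp add: assouad_spectrum_profile_def cap_ok_def)
  \<comment> \<open>The ratio of R to its power is at least 1, because 1/\<theta> > 1 and R <
    1.\<close>
  have mono: "cov_ok V \<beta>" if "cov_ok V \<alpha>" "\<alpha> \<le> \<beta>" for V \<alpha> \<beta>
  proof -
    obtain C where C: "C > 0" "\<And>R x. 0 < R \<Longrightarrow> R < 1 \<Longrightarrow> x \<in> orth_proj V ` X \<Longrightarrow>
        real (covering_number V (R powr (1 / \<theta>)) (orth_proj V ` X \<inter> cball x R))
          \<le> C * (R / R powr (1 / \<theta>)) powr \<alpha>"
      using \<open>cov_ok V \<alpha>\<close> unfolding cov_ok_def by blast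
    have "C * (R / R powr (1 / \<theta>)) powr \<alpha> \<le> C * (R / R powr (1 / \<theta>)) powr \<beta>" if "0 < R" "R < 1" for R
      using that C(1) \<open>\<alpha> \<le> \<beta>\<close> powr_inverse_le_self[OF \<theta> that] by (intro mult_left_mono powr_mono) auto
    then have "\<forall>R x. 0 < R \<and> R < 1 \<and> x \<in> orth_proj V ` X \<longrightarrow>
        real (covering_number V (R powr (1 / \<theta>)) (orth_proj V ` X \<inter> cball x R))
          \<le> C * (R / R powr (1 / \<theta>)) powr \<beta>"
      using order_trans[OF C(2)] by blast
    then show ?thesis
      unfolding cov_ok_def using C(1) by blast
  qed
  \<comment> \<open>The exceptional null set depends on q, so the statement is first proved for each
    q separately and then collected over the rationals.\<close>
  have "AE V in \<gamma>. 0 \<le> q \<and> q < ?s \<longrightarrow> \<not> cov_ok V q" for q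
  proof (cases "0 \<le> q \<and> q < ?s")
    case True
    have "bdd_below {\<alpha>. 0 \<le> \<alpha> \<and> cap_ok \<alpha>}"
      by (auto intro: bdd_belowI[of _ 0])
    then have "\<not> cap_ok q"
      using True cInf_lower[of q "{\<alpha>. 0 \<le> \<alpha> \<and> cap_ok \<alpha>}"] by (auto simp: s)
    then show ?thesis
      using AE_not_spectrum_exponent[OF assms(1) \<theta> \<gamma>, of X q] unfolding cap_ok_def cov_ok_def
      by auto
  qed auto
  then have "AE V in \<gamma>. \<forall>q::rat. 0 \<le> real_of_rat q \<and> real_of_rat q < ?s \<longrightarrow> \<not> cov_ok V (real_of_rat q)"
    by (simp add: AE_all_countable)
  then show ?thesis
    using AE_space
  proof eventually_elim
    case (elim V)
    have "subspace V"
      using elim(2) space_grassmannian_measure[OF \<gamma>] by blast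
    then have "orth_proj V ` X \<subseteq> V"
      using orth_proj_props(1) by blast
    then have "{\<alpha>. 0 \<le> \<alpha> \<and> cov_ok V \<alpha>} \<noteq> {}"
      using assouad_spectrum_exponents_nonempty[OF \<theta>, of "orth_proj V ` X" V] of_nat_0_le_iff
      unfolding cov_ok_def by blast
    moreover have "?s \<le> \<alpha>" if "0 \<le> \<alpha>" "cov_ok V \<alpha>" for \<alpha>
    proof (rule ccontr)
      assume "\<not> ?s \<le> \<alpha>"
      \<comment> \<open>An exponent below the profile would make a rational exponent between the two
        admissible as well, by monotonicity.\<close>
      then obtain q where q: "\<alpha> < real_of_rat q" "real_of_rat q < ?s"
        using of_rat_dense[of \<alpha> ?s] by auto
      moreover have "0 \<le> real_of_rat q"
        using q(1) that(1) by linarith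
      ultimately show False
        using elim(1) mono[OF that(2), of "real_of_rat q"] by auto
    qed
    ultimately have "?s \<le> Inf {\<alpha>. 0 \<le> \<alpha> \<and> cov_ok V \<alpha>}"
      by (intro cInf_greatest) auto
    then show ?case
      by (simp add: assouad_spectrum_def cov_ok_def)
  qed
qed

end
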